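(* Let $A\in\mathbb{R}^{m\times n}$ with $m\ll n$ have full row rank, let $b\in\mathbb{R}^m$, and let $x_*$ denote an optimal solution of the basis pursuit problem $\min_{x\in\mathbb{R}^n}\{\|x\|_1 : Ax=b\}$. Fix $x^{(0)}\in\mathbb{R}^n$, $\eta>0$ with $\eta\ge\|x_*\|_1$, and a sequence of positive parameters $\{(\lambda^{(k)},\epsilon^{(k)},\tau^{(k)})\}_{k\ge 1}$ such that (i) $\lambda^{(k)}\searrow 0$; (ii) $\epsilon^{(k)}\searrow 0$ and there is a constant $B_1$ with $\epsilon^{(k)}/(\lambda^{(k)})^2\le B_1$ for all $k\ge 1$; (iii) $\tau^{(k)}\searrow 0$, there is a constant $B_2$ with $\tau^{(k)}/\lambda^{(k)}\le B_2$ for all $k\ge 1$, and $\tau^{(k)}/\lambda^{(k)}\to 0$ as $k\to\infty$. Let $\mathcal{X}=\{x^{(k)}\}_{k\ge 1}$ be the iterates computed by Algorithm FAL with these inputs (run without termination). Then $\mathcal{X}$ is a bounded sequence and every limit point $\bar x$ of $\mathcal{X}$ is an optimal solution of the basis pursuit problem $\min_{x\in\mathbb{R}^n}\{\|x\|_1: Ax=b\}$.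
   Context: Here $\sigma_{\max}(A)$ is the largest singular value of $A$. Algorithm FAL. Inputs: a sequence $\{(\lambda^{(k)},\epsilon^{(k)},\tau^{(k)})\}_{k\ge1}$ of positive numbers, $x^{(0)}\in\mathbb{R}^n$, and $\eta>0$. Set $\theta^{(1)}=0\in\mathbb{R}^m$ and $L=\sigma_{\max}(A)^2$. For $k=1,2,\dots$: - Define $p^{(k)}(x)=\lambda^{(k)}\|x\|_1$, $f^{(k)}(x)=\tfrac12\|Ax-b-\lambda^{(k)}\theta^{(k)}\|_2^2$, $P^{(k)}=p^{(k)}+f^{(k)}$, $h^{(k)}(x)=\tfrac12\|x-x^{(k-1)}\|_2^2$, $\eta^{(k)}=\eta+\tfrac{\lambda^{(k)}}{2}\|\theta^{(k)}\|_2^2$, $F^{(k)}=\{x\in\mathbb{R}^n:\|x\|_1\le\eta^{(k)}\}$, $\ell^{(k)}_{\max}=\sigma_{\max}(A)\,(\eta^{(k)}+\|x^{(k-1)}\|_2)\sqrt{2/\epsilon^{(k)}}$. - Let $x^{(k)}$ be the output of the subroutine APG described next (applied with $p=p^{(k)}$, $f=f^{(k)}$, $F=F^{(k)}$, $h=h^{(k)}$, Lipschitz constant $L$). - Set $\theta^{(k+1)}=\theta^{(k)}-\dfrac{Ax^{(k)}-b}{\lambda^{(k)}}$. Subroutine APG (accelerated proximal gradient) at outer iteration $k$: set $u^{(0)}=x^{(k-1)}$, $w^{(0)}=\operatorname{argmin}_x h^{(k)}(x)=x^{(k-1)}$, $\vartheta^{(0)}=1$. For $\ell=0,1,2,\dots$: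 - If $\ell\ge\ell^{(k)}_{\max}$, stop and return $u^{(\ell)}$. - Set $v^{(\ell)}=(1-\vartheta^{(\ell)})u^{(\ell)}+\vartheta^{(\ell)}w^{(\ell)}$. If there is a subgradient $g\in\partial P^{(k)}(v^{(\ell)})$ with $\|g\|_2\le\tau^{(k)}$, stop and return $v^{(\ell)}$. - Set $w^{(\ell+1)}=\operatorname{argmin}_{z\in F^{(k)}}\Big\{\sum_{i=0}^{\ell}\tfrac{1}{\vartheta^{(i)}}\big(p^{(k)}(z)+\nabla f^{(k)}(v^{(i)})^Tz\big)+L\,h^{(k)}(z)\Big\}$. - Set $u^{(\ell+1)}=\operatorname{argmin}_{x\in F^{(k)}}\Big\{p^{(k)}(x)+\nabla f^{(k)}(v^{(\ell)})^Tx+\tfrac{L}{2}\|x-v^{(\ell)}\|_2^2\Big\}$. - Set $\vartheta^{(\ell+1)}=\tfrac12\Big(\sqrt{(\vartheta^{(\ell)})^4+4(\vartheta^{(\ell)})^2}-(\vartheta^{(\ell)})^2\Big)$. *)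

theory Defs
  imports "HOL-Analysis.Analysis"
begin

section \<open>Norms, gradients and subgradients\<close>

definition l1_norm :: "real ^ 'n \<Rightarrow> real" where
  "l1_norm x = (\<Sum>i\<in>UNIV. \<bar>x $ i\<bar>)"

definition singular_values :: "real ^ 'n ^ 'm \<Rightarrow> real set" where
  "singular_values A =
     {sqrt e | e. \<exists>v. v \<noteq> 0 \<and> (transpose A ** A) *v v = e *\<^sub>R v}"

definition sigma_max :: "real ^ 'n ^ 'm \<Rightarrow> real" where
  "sigma_max A = (GREATEST s. s \<in> singular_values A)"

definition gradient :: "('a::real_inner \<Rightarrow> real) \<Rightarrow> 'a \<Rightarrow> 'a" where
  "gradient f x = (THE g. GDERIV f x :> g)"

definition subdifferential :: "('a::real_inner \<Rightarrow> real) \<Rightarrow> 'a \<Rightarrow> 'a set" where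
  "subdifferential P v = {g. \<forall>y. P v + g \<bullet> (y - v) \<le> P y}"

definition basis_pursuit_solution :: "real ^ 'n ^ 'm \<Rightarrow> real ^ 'm \<Rightarrow> real ^ 'n \<Rightarrow> bool" where
  "basis_pursuit_solution A b = is_arg_min l1_norm (\<lambda>x. A *v x = b)"

definition limit_point :: "(nat \<Rightarrow> 'a::topological_space) \<Rightarrow> 'a \<Rightarrow> bool" where
  "limit_point X a \<longleftrightarrow> (\<exists>r. strict_mono r \<and> (X \<circ> r) \<longlonglongrightarrow> a)"


section \<open>The subroutine APG\<close>

primrec apg_vartheta :: "nat \<Rightarrow> real" where
  "apg_vartheta 0 = 1"
| "apg_vartheta (Suc l) =
     (sqrt (apg_vartheta l ^ 4 + 4 * apg_vartheta l ^ 2) - apg_vartheta l ^ 2) / 2"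

text \<open>
  The inner sequences are defined for every index, ignoring the stopping tests;
  \<open>apg_output\<close> below selects the first index at which one of the tests succeeds. The
  argument \<open>x\<close> is the initial point. In algorithm FAL the set \<open>F\<close> is compact and,
  if \<open>L > 0\<close>, the objectives minimised over it are continuous and strictly convex, so
  \<^const>\<open>arg_min_on\<close> picks the unique minimiser.
\<close>

context
  fixes p f h :: "'a::real_inner \<Rightarrow> real"
    and F :: "'a set"
    and L :: real
    and x :: 'a
begin

function (sequential)
  apg_u :: "nat \<Rightarrow> 'a" and apg_v :: "nat \<Rightarrow> 'a" and apg_w :: "nat \<Rightarrow> 'a"
where
  "apg_u 0 = x"
| "apg_u (Suc l) =
     arg_min_on (\<lambda>z. p z + gradient f (apg_v l) \<bullet> z + L / 2 * norm (z - apg_v l) ^ 2) F"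
| "apg_v l = (1 - apg_vartheta l) *\<^sub>R apg_u l + apg_vartheta l *\<^sub>R apg_w l"
| "apg_w 0 = arg_min_on h UNIV"
| "apg_w (Suc l) =
     arg_min_on
       (\<lambda>z. (\<Sum>i\<le>l. 1 / apg_vartheta i * (p z + gradient f (apg_v i) \<bullet> z)) + L * h z) F"
  by pat_completeness auto
termination
  by (relation "Wellfounded.measure (case_sum (\<lambda>l. 2 * l) (case_sum (\<lambda>l. 2 * l + 1) (\<lambda>l. 2 * l)))") auto

definition apg_stop :: "real \<Rightarrow> real \<Rightarrow> nat \<Rightarrow> bool" where
  "apg_stop lmax tau l \<longleftrightarrow>
     lmax \<le> real l \<or> (\<exists>g \<in> subdifferential (\<lambda>z. p z + f z) (apg_v l). norm g \<le> tau)"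

definition apg_output :: "real \<Rightarrow> real \<Rightarrow> 'a" where
  "apg_output lmax tau =
     (let l = (LEAST l. apg_stop lmax tau l)
      in if lmax \<le> real l then apg_u l else apg_v l)"

end


section \<open>Algorithm FAL\<close>

text \<open>
  One outer iteration: the arguments \<open>lam eps tau\<close> are the parameters of iteration \<open>k\<close>,
  and \<open>th\<close>, \<open>x\<close> are the multiplier \<open>\<theta>\<close> of iteration \<open>k\<close> and the iterate \<open>x\<close> of
  iteration \<open>k - 1\<close>.
\<close>

definition fal_step ::
  "real ^ 'n ^ 'm \<Rightarrow> real ^ 'm \<Rightarrow> real \<Rightarrow> real \<Rightarrow> real \<Rightarrow> real \<Rightarrow> real ^ 'm \<Rightarrow> real ^ 'n \<Rightarrow> real ^ 'n"
where
  "fal_step A b eta lam eps tau th x =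
     (let p = (\<lambda>z. lam * l1_norm z);
          f = (\<lambda>z. 1 / 2 * norm (A *v z - b - lam *\<^sub>R th) ^ 2);
          h = (\<lambda>z. 1 / 2 * norm (z - x) ^ 2);
          eta' = eta + lam / 2 * norm th ^ 2;
          F = {z. l1_norm z \<le> eta'};
          L = sigma_max A ^ 2;
          lmax = sigma_max A * (eta' + norm x) * sqrt (2 / eps)
      in apg_output p f h F L x lmax tau)"

text \<open>
  The parameter sequences and the multipliers are indexed from 1; their values at index 0
  are never used.
\<close>

context
  fixes A :: "real ^ 'n ^ 'm" and b :: "real ^ 'm"
    and lam eps tau :: "nat \<Rightarrow> real"
    and x0 :: "real ^ 'n" and eta :: real
begin

function (sequential) fal_x :: "nat \<Rightarrow> real ^ 'n" and fal_theta :: "nat \<Rightarrow> real ^ 'm" where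
  "fal_x 0 = x0"
| "fal_x (Suc k) =
     fal_step A b eta (lam (Suc k)) (eps (Suc k)) (tau (Suc k)) (fal_theta (Suc k)) (fal_x k)"
| "fal_theta 0 = 0"
| "fal_theta (Suc 0) = 0"
| "fal_theta (Suc (Suc k)) =
     fal_theta (Suc k) - (1 / lam (Suc k)) *\<^sub>R (A *v fal_x (Suc k) - b)"
  by pat_completeness auto
termination
  by (relation "Wellfounded.measure (case_sum (\<lambda>k. 2 * k) (\<lambda>k. 2 * k - 1))") auto

end

end

theory Submission
  imports Defs
begin

text \<open>
  Whichever test stops APG, the new iterate has an \<open>\<epsilon>\<close>-subgradient of
  \<open>P\<close> of norm at most \<open>\<tau>\<close>: either by the \<open>O(1 / \<ell>\<^sup>2)\<close> rate of the
  accelerated method (then the subgradient is \<open>0\<close>), or by the second test (then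
  \<open>\<epsilon> = 0\<close> would do). Evaluated at a point at distance \<open>\<lambda>\<close> from the iterate, the
  subgradient inequality bounds the transpose of \<open>A\<close> applied to the next multiplier, because
  \<open>\<epsilon> / \<lambda>\<^sup>2\<close> and \<open>\<tau> / \<lambda>\<close> are bounded; full row rank then bounds the
  multipliers, and the residuals \<open>\<lambda>\<^sub>k (\<theta>\<^sub>k - \<theta>\<^sub>k\<^sub>+\<^sub>1)\<close> tend to \<open>0\<close>.
  Evaluated at the basis pursuit solution and divided by \<open>\<lambda>\<close>, the same inequality bounds
  the 1-norm of the iterates, in the limit by the optimal value.
\<close>

section \<open>Minimisers over compact sets\<close>

text \<open>\<open>arg_min_on\<close> is a choice operator, so it yields a minimiser as soon as one
  exists; compactness and continuity supply one.\<close>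

lemma arg_min_on_compact:
  fixes g :: "'a::topological_space \<Rightarrow> real"
  assumes "compact S" "S \<noteq> {}" "continuous_on S g"
  shows "arg_min_on g S \<in> S" and "\<And>y. y \<in> S \<Longrightarrow> g (arg_min_on g S) \<le> g y"
proof -
  obtain z where "z \<in> S" "\<forall>y\<in>S. g z \<le> g y"
    using continuous_attains_inf[OF assms] by blast
  then have "is_arg_min g (\<lambda>y. y \<in> S) z"
    by (auto simp: is_arg_min_linorder)
  then have "is_arg_min g (\<lambda>y. y \<in> S) (arg_min_on g S)"
    unfolding arg_min_on_def arg_min_def by (rule someI)
  then show "arg_min_on g S \<in> S" and "\<And>y. y \<in> S \<Longrightarrow> g (arg_min_on g S) \<le> g y"
    by (auto simp: is_arg_min_linorder)
qed

lemma norm_convex_combination_square: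
  fixes a b :: "'a::real_inner"
  shows "(norm ((1 - t) *\<^sub>R a + t *\<^sub>R b))\<^sup>2
    = (1 - t) * (norm a)\<^sup>2 + t * (norm b)\<^sup>2 - t * (1 - t) * (norm (b - a))\<^sup>2"
  by (simp add: power2_norm_eq_inner inner_add_left inner_add_right inner_diff_left
      inner_diff_right inner_commute) algebra

text \<open>The proximal term makes the objective strongly convex with modulus \<open>L\<close>,
  hence it grows quadratically away from a minimiser. The proof compares \<open>w\<close> with
  points of the segment towards \<open>z\<close>.\<close>

lemma prox_minimiser_growth:
  fixes c :: "'a::real_inner \<Rightarrow> real"
  assumes F: "convex F" and c: "convex_on F c" and w: "w \<in> F" and z: "z \<in> F" and L: "L \<ge> 0"
    and min: "\<And>y. y \<in> F \<Longrightarrow>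
      c w + L / 2 * (norm (w - x))\<^sup>2 \<le> c y + L / 2 * (norm (y - x))\<^sup>2"
  shows "c w + L / 2 * (norm (w - x))\<^sup>2 + L / 2 * (norm (z - w))\<^sup>2
    \<le> c z + L / 2 * (norm (z - x))\<^sup>2"
proof -
  \<comment> \<open>Here \<open>1 - s\<close> is the fraction of the way from \<open>w\<close> to
    \<open>z\<close>. Dividing the minimality inequality by it leaves the factor \<open>s\<close> on
    the growth term; then \<open>s\<close> is sent to 1.\<close>
  have "s * (L / 2 * (norm (z - w))\<^sup>2)
      \<le> c z + L / 2 * (norm (z - x))\<^sup>2 - (c w + L / 2 * (norm (w - x))\<^sup>2)"
    if s: "0 < s" "s < 1" for s
  proof -
    define t where "t = 1 - s"
    have t: "0 < t" "t < 1" using s by (auto simp: t_def)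
    define y where "y = (1 - t) *\<^sub>R w + t *\<^sub>R z"
    have y: "y \<in> F" unfolding y_def using F w z t by (simp add: convexD)
    have cy: "c y \<le> (1 - t) * c w + t * c z"
      unfolding y_def using convex_onD[OF c, of t w z] t w z by simp
    have "y - x = (1 - t) *\<^sub>R (w - x) + t *\<^sub>R (z - x)"
      by (simp add: y_def algebra_simps)
    then have ny: "(norm (y - x))\<^sup>2
        = (1 - t) * (norm (w - x))\<^sup>2 + t * (norm (z - x))\<^sup>2 - t * (1 - t) * (norm (z - w))\<^sup>2"
      by (simp add: norm_convex_combination_square)
    have "0 \<le> t * (c z + L / 2 * (norm (z - x))\<^sup>2 - (c w + L / 2 * (norm (w - x))\<^sup>2)
        - (1 - t) * (L / 2 * (norm (z - w))\<^sup>2))"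
      using min[OF y] cy unfolding ny by (simp add: field_simps)
    then show ?thesis using t by (simp add: zero_le_mult_iff t_def)
  qed
  then have "L / 2 * (norm (z - w))\<^sup>2
      \<le> c z + L / 2 * (norm (z - x))\<^sup>2 - (c w + L / 2 * (norm (w - x))\<^sup>2)"
    by (rule field_le_mult_one_interval)
  then show ?thesis by simp
qed


section \<open>Convergence rate of APG\<close>

lemma apg_vartheta_pos: "apg_vartheta l > 0"
proof (induction l)
  case (Suc l)
  have "apg_vartheta l ^ 2 < sqrt (apg_vartheta l ^ 4 + 4 * apg_vartheta l ^ 2)"
    using Suc by (intro real_less_rsqrt) (simp flip: power_mult)
  then show ?case by simp
qed simp

text \<open>The recursion picks the positive root \<open>t\<close> of
  \<open>t^2 = (1 - t) * a\<close>, where \<open>a\<close> is the square of the previous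
  parameter.\<close>

lemma apg_vartheta_Suc_square:
  "(apg_vartheta (Suc l))\<^sup>2 = (1 - apg_vartheta (Suc l)) * (apg_vartheta l)\<^sup>2"
proof -
  define a where "a = (apg_vartheta l)\<^sup>2"
  define r where "r = sqrt (apg_vartheta l ^ 4 + 4 * apg_vartheta l ^ 2)"
  have a2: "apg_vartheta l ^ 4 = a\<^sup>2" by (simp add: a_def flip: power_mult)
  have r2: "r\<^sup>2 = a\<^sup>2 + 4 * a"
    unfolding r_def a2 by (simp add: a_def[symmetric]) (simp add: a_def)
  have th: "apg_vartheta (Suc l) = (r - a) / 2"
    by (simp add: a_def r_def)
  show ?thesis
    unfolding th a_def[symmetric] using r2 by (simp add: power2_eq_square field_simps)
qed

lemma apg_vartheta_Suc_le_1: "apg_vartheta (Suc l) \<le> 1"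
proof -
  have "0 \<le> (1 - apg_vartheta (Suc l)) * (apg_vartheta l)\<^sup>2"
    by (metis apg_vartheta_Suc_square zero_le_power2)
  then show ?thesis
    using apg_vartheta_pos[of l] by (simp add: zero_le_mult_iff del: apg_vartheta.simps)
qed

lemma apg_vartheta_le_1: "apg_vartheta l \<le> 1"
  using apg_vartheta_Suc_le_1 by (cases l) auto

lemma apg_vartheta_Suc_quotient:
  "(1 - apg_vartheta (Suc l)) / (apg_vartheta (Suc l))\<^sup>2 = 1 / (apg_vartheta l)\<^sup>2"
proof -
  have "apg_vartheta l \<noteq> 0" "apg_vartheta (Suc l) \<noteq> 0"
    using apg_vartheta_pos less_irrefl by metis+
  then show ?thesis
    using apg_vartheta_Suc_square[of l] by (simp add: field_simps del: apg_vartheta.simps)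
qed

text \<open>Telescoping: by the recursion, the increments of \<open>1 / vartheta^2\<close> are
  exactly \<open>1 / vartheta\<close>. The sum is the total weight in \<open>model\<close>
  below.\<close>

lemma sum_inverse_apg_vartheta: "(\<Sum>i\<le>l. 1 / apg_vartheta i) = 1 / (apg_vartheta l)\<^sup>2"
proof (induction l)
  case (Suc l)
  have "1 / (apg_vartheta (Suc l))\<^sup>2 = 1 / (apg_vartheta l)\<^sup>2 + 1 / apg_vartheta (Suc l)"
    using apg_vartheta_pos[of "Suc l"] apg_vartheta_Suc_quotient[of l, symmetric]
    by (simp add: field_simps power2_eq_square del: apg_vartheta.simps)
  then show ?case using Suc by (simp del: apg_vartheta.simps)
qed simp

text \<open>Consecutive reciprocals satisfy \<open>s'^2 - s' = s^2\<close>; completing the square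
  shows that each step raises the reciprocal by at least 1/2.\<close>

lemma apg_vartheta_le: "apg_vartheta l \<le> 2 / (real l + 2)"
proof -
  have "1 + real l / 2 \<le> 1 / apg_vartheta l"
  proof (induction l)
    case (Suc l)
    define s where "s = 1 / apg_vartheta l"
    define s' where "s' = 1 / apg_vartheta (Suc l)"
    have s: "s > 0" unfolding s_def using apg_vartheta_pos[of l] by simp
    have s': "s' \<ge> 1" unfolding s'_def
      using apg_vartheta_pos[of "Suc l"] apg_vartheta_Suc_le_1[of l]
      by (simp del: apg_vartheta.simps)
    have "s'\<^sup>2 - s' = s\<^sup>2"
      using apg_vartheta_Suc_quotient[of l] apg_vartheta_pos[of "Suc l"]
      by (simp add: s_def s'_def field_simps power2_eq_square del: apg_vartheta.simps)
    moreover have "(s' - 1 / 2)\<^sup>2 = s'\<^sup>2 - s' + 1 / 4" by (simp add: power2_diff power_one_over)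
    ultimately have "s\<^sup>2 \<le> (s' - 1 / 2)\<^sup>2" by linarith
    then have "s \<le> s' - 1 / 2" by (rule power2_le_imp_le) (use s' in simp)
    then show ?case using Suc by (simp add: s_def s'_def field_simps del: apg_vartheta.simps)
  qed simp
  then show ?thesis using apg_vartheta_pos[of l] by (simp add: field_simps)
qed

text \<open>\<open>lower\<close> expresses convexity of \<open>f\<close> and \<open>upper\<close>
  its smoothness with constant \<open>L\<close>. They range over the whole space because APG takes
  its first gradient at \<open>x\<close>, which may lie outside \<open>F\<close>.\<close>

context
  fixes p f h :: "'a::real_inner \<Rightarrow> real" and F :: "'a set" and L :: real and x :: 'a
  assumes F: "compact F" "convex F" "F \<noteq> {}"
    and p: "convex_on F p" "continuous_on F p"
    and L: "L \<ge> 0" and h: "h = (\<lambda>z. 1 / 2 * (norm (z - x))\<^sup>2)"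
    and lower: "\<And>v y. f v + gradient f v \<bullet> (y - v) \<le> f y"
    and upper: "\<And>v y. f y \<le> f v + gradient f v \<bullet> (y - v) + L / 2 * (norm (y - v))\<^sup>2"
begin

private abbreviation (input) "uu \<equiv> apg_u p f h F L x"
private abbreviation (input) "vv \<equiv> apg_v p f h F L x"
private abbreviation (input) "ww \<equiv> apg_w p f h F L x"

text \<open>Nesterov's aggregated model: the objective of the \<open>w\<close>-step without its
  proximal term, with the constants dropped there restored, so that every summand is a weighted
  minorant of \<open>p + f\<close>.\<close>

definition model :: "nat \<Rightarrow> 'a \<Rightarrow> real" where
  "model l z = (\<Sum>i\<le>l. 1 / apg_vartheta i * (p z + f (vv i) + gradient f (vv i) \<bullet> (z - vv i)))"

lemma apg_w_0: "ww 0 = x"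
proof -
  have "is_arg_min h (\<lambda>y. y \<in> UNIV) x" by (simp add: is_arg_min_linorder h)
  then have "is_arg_min h (\<lambda>y. y \<in> UNIV) (arg_min_on h UNIV)"
    unfolding arg_min_on_def arg_min_def by (rule someI)
  then have "h (arg_min_on h UNIV) \<le> h x" by (simp only: is_arg_min_linorder UNIV_I)
  then have "arg_min_on h UNIV = x" by (simp add: h)
  then show ?thesis by (simp only: apg_w.simps)
qed

lemma apg_v_0: "vv 0 = x"
  using apg_w_0 by (simp del: apg_w.simps)

lemma apg_u_Suc:
  shows "uu (Suc l) \<in> F"
    and "y \<in> F \<Longrightarrow>
      p (uu (Suc l)) + gradient f (vv l) \<bullet> uu (Suc l) + L / 2 * (norm (uu (Suc l) - vv l))\<^sup>2
      \<le> p y + gradient f (vv l) \<bullet> y + L / 2 * (norm (y - vv l))\<^sup>2"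
proof -
  have c: "continuous_on F (\<lambda>z. p z + gradient f (vv l) \<bullet> z + L / 2 * (norm (z - vv l))\<^sup>2)"
    by (intro continuous_intros p)
  note * = arg_min_on_compact[OF F(1,3) c]
  show "uu (Suc l) \<in> F" using *(1) by (simp del: apg_v.simps)
  show "y \<in> F \<Longrightarrow>
      p (uu (Suc l)) + gradient f (vv l) \<bullet> uu (Suc l) + L / 2 * (norm (uu (Suc l) - vv l))\<^sup>2
      \<le> p y + gradient f (vv l) \<bullet> y + L / 2 * (norm (y - vv l))\<^sup>2"
    using *(2)[of y] by (simp del: apg_v.simps)
qed

text \<open>By \<open>upper\<close>, the quadratic model at \<open>v\<close> majorises
  \<open>f\<close>; the new \<open>u\<close> minimises \<open>p\<close> plus this majorant over
  \<open>F\<close>.\<close>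

lemma apg_u_Suc_le:
  assumes "y \<in> F"
  shows "p (uu (Suc l)) + f (uu (Suc l))
    \<le> p y + f (vv l) + gradient f (vv l) \<bullet> (y - vv l) + L / 2 * (norm (y - vv l))\<^sup>2"
  using apg_u_Suc(2)[OF assms, of l] upper[of "uu (Suc l)" "vv l"]
  by (simp add: inner_diff_right del: apg_u.simps apg_v.simps)

lemma apg_w_Suc:
  shows "ww (Suc l) \<in> F"
    and "y \<in> F \<Longrightarrow> model l (ww (Suc l)) + L / 2 * (norm (ww (Suc l) - x))\<^sup>2
      \<le> model l y + L / 2 * (norm (y - x))\<^sup>2"
proof -
  let ?g = "\<lambda>z. (\<Sum>i\<le>l. 1 / apg_vartheta i * (p z + gradient f (vv i) \<bullet> z)) + L * h z"
  have c: "continuous_on F ?g"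
    unfolding h by (intro continuous_intros p)
  note * = arg_min_on_compact[OF F(1,3) c]
  have w: "ww (Suc l) = arg_min_on ?g F" by (simp del: apg_v.simps)
  show "ww (Suc l) \<in> F" using *(1) unfolding w .
  have eq: "model l z + L / 2 * (norm (z - x))\<^sup>2
      = ?g z + (\<Sum>i\<le>l. 1 / apg_vartheta i * (f (vv i) - gradient f (vv i) \<bullet> vv i))" for z
  proof -
    have "1 / apg_vartheta i * (p z + f (vv i) + gradient f (vv i) \<bullet> (z - vv i))
        = 1 / apg_vartheta i * (p z + gradient f (vv i) \<bullet> z)
          + 1 / apg_vartheta i * (f (vv i) - gradient f (vv i) \<bullet> vv i)" for i
      by (simp only: distrib_left[symmetric] inner_diff_right) simp
    then have "model l z = (\<Sum>i\<le>l. 1 / apg_vartheta i * (p z + gradient f (vv i) \<bullet> z))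
        + (\<Sum>i\<le>l. 1 / apg_vartheta i * (f (vv i) - gradient f (vv i) \<bullet> vv i))"
      unfolding model_def by (simp only: sum.distrib)
    then show ?thesis by (simp add: h)
  qed
  show "y \<in> F \<Longrightarrow> model l (ww (Suc l)) + L / 2 * (norm (ww (Suc l) - x))\<^sup>2
      \<le> model l y + L / 2 * (norm (y - x))\<^sup>2"
    unfolding eq using *(2)[of y] unfolding w by simp
qed

lemma convex_on_model: "convex_on F (model l)"
proof -
  have lin: "convex_on F (\<lambda>z. f (vv i) + gradient f (vv i) \<bullet> (z - vv i))" for i
    by (auto intro!: convex_onI simp: F algebra_simps
        simp del: apg_v.simps)
  have "convex_on F (\<lambda>z. p z + (f (vv i) + gradient f (vv i) \<bullet> (z - vv i)))" for i
    by (intro convex_on_add p lin)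
  then have summand: "convex_on F (\<lambda>z. 1 / apg_vartheta i *
      (p z + f (vv i) + gradient f (vv i) \<bullet> (z - vv i)))" for i
    using apg_vartheta_pos[of i] by (intro convex_on_cmul) (simp_all only: add.assoc, simp)
  show ?thesis
    unfolding model_def[abs_def]
  proof (induction l)
    case 0
    show ?case using summand[of 0] by (simp only: atMost_0) simp
  next
    case (Suc l)
    show ?case using convex_on_add[OF Suc summand] by (simp only: sum.atMost_Suc)
  qed
qed

text \<open>By \<open>lower\<close> each summand is a minorant, and the weights add up to
  \<open>1 / vartheta^2\<close>.\<close>

lemma model_le: "model l z \<le> 1 / (apg_vartheta l)\<^sup>2 * (p z + f z)"
proof -
  have "model l z \<le> (\<Sum>i\<le>l. 1 / apg_vartheta i * (p z + f z))"
    unfolding model_def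
  proof (intro sum_mono mult_left_mono)
    show "p z + f (vv i) + gradient f (vv i) \<bullet> (z - vv i) \<le> p z + f z" for i
      using lower[of "vv i" z] by simp
    show "0 \<le> 1 / apg_vartheta i" for i using apg_vartheta_pos[of i] by simp
  qed
  also have "\<dots> = 1 / (apg_vartheta l)\<^sup>2 * (p z + f z)"
    by (simp only: sum_distrib_right[symmetric] sum_inverse_apg_vartheta)
  finally show ?thesis .
qed

text \<open>Nesterov's estimate sequence: the scaled objective stays below the minimum of the
  aggregated model.\<close>

lemma apg_estimate_sequence:
  "1 / (apg_vartheta l)\<^sup>2 * (p (uu (Suc l)) + f (uu (Suc l)))
    \<le> model l (ww (Suc l)) + L / 2 * (norm (ww (Suc l) - x))\<^sup>2"
proof (induction l)
  case 0
  show ?case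
    \<comment> \<open>The first parameter is 1 and the first \<open>v\<close> is \<open>x\<close>,
      so the one-term model plus the proximal term is exactly the majorant at
      \<open>x\<close>.\<close>
    using apg_u_Suc_le[OF apg_w_Suc(1)[of 0], of 0]
    by (simp add: model_def apg_v_0 del: apg_u.simps apg_v.simps apg_w.simps)
next
  case (Suc l)
  define th where "th = apg_vartheta (Suc l)"
  define u where "u = uu (Suc l)"
  define w where "w = ww (Suc l)"
  define w' where "w' = ww (Suc (Suc l))"
  define v where "v = vv (Suc l)"
  \<comment> \<open>The test point for the next \<open>u\<close>: it is built like \<open>v\<close>,
    but with the new \<open>w'\<close> instead of \<open>w\<close>. Then \<open>z - v\<close> is
    \<open>th\<close> times \<open>w' - w\<close>, and the resulting \<open>th^2\<close> cancels
    against the scaling \<open>1 / th^2\<close>.\<close>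
  define z where "z = (1 - th) *\<^sub>R u + th *\<^sub>R w'"
  define lin where "lin = (\<lambda>y. f v + gradient f v \<bullet> (y - v))"
  have th: "0 < th" "th \<le> 1"
    unfolding th_def using apg_vartheta_pos apg_vartheta_le_1 by blast+
  have inF: "u \<in> F" "w \<in> F" "w' \<in> F"
    unfolding u_def w_def w'_def using apg_u_Suc(1) apg_w_Suc(1) by blast+
  have zF: "z \<in> F"
    unfolding z_def using F inF th by (simp add: convexD)
  have v: "v = (1 - th) *\<^sub>R u + th *\<^sub>R w"
    unfolding v_def u_def w_def th_def by (simp only: apg_v.simps)
  have zv: "z - v = th *\<^sub>R (w' - w)"
    by (simp add: z_def v algebra_simps)
  have pz: "p z \<le> (1 - th) * p u + th * p w'"
    unfolding z_def using convex_onD[OF p(1), of th u w'] th inF by simp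
  have lz: "lin z = (1 - th) * lin u + th * lin w'"
    by (simp add: lin_def z_def algebra_simps)
  have lu: "lin u \<le> f u" unfolding lin_def by (rule lower)
  have "p (uu (Suc (Suc l))) + f (uu (Suc (Suc l)))
      \<le> p z + lin z + L / 2 * (norm (z - v))\<^sup>2"
    using apg_u_Suc_le[OF zF, of "Suc l"] unfolding v_def[symmetric] lin_def by simp
  also have "\<dots> \<le> (1 - th) * (p u + f u) + th * (p w' + lin w')
      + th\<^sup>2 * (L / 2 * (norm (w' - w))\<^sup>2)"
  proof -
    have "L / 2 * (norm (z - v))\<^sup>2 = th\<^sup>2 * (L / 2 * (norm (w' - w))\<^sup>2)"
      by (simp add: zv power_mult_distrib)
    moreover have "(1 - th) * lin u \<le> (1 - th) * f u"
      using lu th by (intro mult_left_mono) auto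
    ultimately show ?thesis using pz lz unfolding distrib_left by linarith
  qed
  finally have "1 / th\<^sup>2 * (p (uu (Suc (Suc l))) + f (uu (Suc (Suc l))))
      \<le> 1 / th\<^sup>2 * ((1 - th) * (p u + f u) + th * (p w' + lin w')
        + th\<^sup>2 * (L / 2 * (norm (w' - w))\<^sup>2))"
    using th by (intro mult_left_mono) auto
  also have "\<dots> = (1 - th) / th\<^sup>2 * (p u + f u) + 1 / th * (p w' + lin w')
        + L / 2 * (norm (w' - w))\<^sup>2"
    using th by (simp add: field_simps power2_eq_square)
  \<comment> \<open>The recursion for the parameters turns this weight into the one of the induction
    hypothesis.\<close>
  also have "(1 - th) / th\<^sup>2 = 1 / (apg_vartheta l)\<^sup>2"
    unfolding th_def by (rule apg_vartheta_Suc_quotient)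
  also have "1 / (apg_vartheta l)\<^sup>2 * (p u + f u)
      \<le> model l w + L / 2 * (norm (w - x))\<^sup>2"
    using Suc.IH unfolding u_def w_def .
  \<comment> \<open>The quadratic growth around the minimiser \<open>w\<close> absorbs the remaining
    square of \<open>norm (w' - w)\<close>.\<close>
  also have "model l w + L / 2 * (norm (w - x))\<^sup>2 + 1 / th * (p w' + lin w')
        + L / 2 * (norm (w' - w))\<^sup>2
      \<le> model l w' + L / 2 * (norm (w' - x))\<^sup>2 + 1 / th * (p w' + lin w')"
    using prox_minimiser_growth[OF F(2) convex_on_model inF(2,3) L, of l x]
      apg_w_Suc(2) unfolding w_def by simp
  also have "\<dots> = model (Suc l) w' + L / 2 * (norm (w' - x))\<^sup>2"
    by (simp add: model_def lin_def v_def th_def add.assoc del: apg_v.simps apg_vartheta.simps)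
  finally show ?case unfolding th_def w'_def by simp
qed

text \<open>In the estimate sequence the minimiser \<open>w\<close> is replaced by \<open>y\<close>
  and the model by its upper bound; multiplying by \<open>vartheta^2\<close>, which is at most
  \<open>4 / (l + 2)^2\<close>, gives the rate.\<close>

lemma apg_u_rate:
  assumes y: "y \<in> F"
  shows "p (uu (Suc l)) + f (uu (Suc l))
    \<le> p y + f y + 2 * L * (norm (y - x))\<^sup>2 / (real l + 2)\<^sup>2"
proof -
  let ?t = "apg_vartheta l"
  have t: "0 < ?t" "?t \<le> 2 / (real l + 2)"
    using apg_vartheta_pos apg_vartheta_le by blast+
  have "1 / ?t\<^sup>2 * (p (uu (Suc l)) + f (uu (Suc l)))
      \<le> 1 / ?t\<^sup>2 * (p y + f y) + L / 2 * (norm (y - x))\<^sup>2"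
    using apg_estimate_sequence[of l] apg_w_Suc(2)[OF y, of l] model_le[of l y] by linarith
  then have "?t\<^sup>2 * (1 / ?t\<^sup>2 * (p (uu (Suc l)) + f (uu (Suc l))))
      \<le> ?t\<^sup>2 * (1 / ?t\<^sup>2 * (p y + f y) + L / 2 * (norm (y - x))\<^sup>2)"
    by (rule mult_left_mono) simp
  then have "p (uu (Suc l)) + f (uu (Suc l)) \<le> p y + f y + ?t\<^sup>2 * (L / 2 * (norm (y - x))\<^sup>2)"
    using t by (simp add: distrib_left del: apg_u.simps)
  also have "?t\<^sup>2 * (L / 2 * (norm (y - x))\<^sup>2) \<le> (2 / (real l + 2))\<^sup>2 * (L / 2 * (norm (y - x))\<^sup>2)"
    using t L by (intro mult_right_mono power_mono) auto
  also have "\<dots> = 2 * L * (norm (y - x))\<^sup>2 / (real l + 2)\<^sup>2"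
    by (simp add: power2_eq_square)
  finally show ?thesis by simp
qed

lemma apg_output_cases:
  fixes tau :: real
  assumes lmax: "lmax > 0"
    and rate: "\<And>y. y \<in> F \<Longrightarrow> 2 * L * (norm (y - x))\<^sup>2 \<le> e * lmax\<^sup>2" and e: "e \<ge> 0"
  defines "out \<equiv> apg_output p f h F L x lmax tau"
  shows "(out \<in> F \<and> (\<forall>y\<in>F. p out + f out \<le> p y + f y + e))
    \<or> (\<exists>g\<in>subdifferential (\<lambda>z. p z + f z) out. norm g \<le> tau)"
proof -
  let ?stop = "apg_stop p f h F L x lmax tau"
  define l where "l = (LEAST l. ?stop l)"
  \<comment> \<open>Some index passes a test, so the \<open>LEAST\<close> in
    \<open>apg_output\<close> is attained.\<close>
  have "?stop (nat \<lceil>lmax\<rceil>)"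
    unfolding apg_stop_def using real_nat_ceiling_ge by blast
  then have stop: "?stop l" unfolding l_def by (rule LeastI)
  have out: "out = (if lmax \<le> real l then uu l else vv l)"
    unfolding out_def apg_output_def l_def Let_def ..
  show ?thesis
  proof (cases "lmax \<le> real l")
    case True
    \<comment> \<open>Positivity of \<open>lmax\<close> excludes the starting point: the returned
      \<open>u\<close> results from at least one step, so it lies in \<open>F\<close> and the rate
      applies.\<close>
    then obtain j where j: "l = Suc j" using lmax by (cases l) auto
    have "p (uu l) + f (uu l) \<le> p y + f y + e" if y: "y \<in> F" for y
    proof -
      have "lmax\<^sup>2 \<le> (real j + 2)\<^sup>2"
        using True lmax by (intro power_mono) (auto simp: j)
      then have "2 * L * (norm (y - x))\<^sup>2 \<le> e * (real j + 2)\<^sup>2"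
        using rate[OF y] mult_left_mono[OF _ e] by (meson order_trans)
      then have "2 * L * (norm (y - x))\<^sup>2 / (real j + 2)\<^sup>2 \<le> e"
        by (subst pos_divide_le_eq) auto
      then show ?thesis using apg_u_rate[OF y, of j] unfolding j by linarith
    qed
    then show ?thesis
      using True apg_u_Suc(1)[of j] unfolding out j by simp
  next
    case False
    then show ?thesis using stop unfolding out apg_stop_def by simp
  qed
qed

end


section \<open>The largest singular value\<close>

lemma inner_transpose_mult:
  fixes A :: "real ^ 'n ^ 'm"
  shows "(transpose A *v y) \<bullet> x = y \<bullet> (A *v x)"
  by (metis dot_lmul_matrix transpose_matrix_vector)

lemma norm_transpose_mult_le:
  fixes A :: "real ^ 'n ^ 'm"
  assumes "\<And>v. norm (A *v v) \<le> s * norm v"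
  shows "norm (transpose A *v y) \<le> s * norm y"
proof (cases "transpose A *v y = 0")
  case True
  \<comment> \<open>An arbitrary unit vector shows that \<open>s\<close> is nonnegative.\<close>
  have "0 \<le> norm (A *v axis undefined 1)" by simp
  also have "\<dots> \<le> s" using assms[of "axis undefined 1"] by simp
  finally show ?thesis using True by simp
next
  case False
  have "norm (transpose A *v y) * norm (transpose A *v y) = y \<bullet> (A *v (transpose A *v y))"
    by (simp only: inner_transpose_mult[symmetric] power2_norm_eq_inner[symmetric] power2_eq_square)
  also have "\<dots> \<le> norm y * (s * norm (transpose A *v y))"
    by (meson Cauchy_Schwarz_ineq2 abs_le_D1 assms mult_left_mono norm_ge_zero order_trans)
  finally have "norm (transpose A *v y) * norm (transpose A *v y)
      \<le> (s * norm y) * norm (transpose A *v y)" by (simp add: mult_ac)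
  then show ?thesis using False by simp
qed

text \<open>A unit vector maximising \<open>norm (A *v v)\<close> is an eigenvector of
  \<open>transpose A ** A\<close> for the squared operator norm, and no eigenvalue exceeds that
  square. Thus the \<open>GREATEST\<close> in \<open>sigma_max\<close> is attained.\<close>

lemma sigma_max_eq_onorm: "sigma_max A = onorm ((*v) A)"
  for A :: "real ^ 'n ^ 'm"
proof -
  let ?s = "onorm ((*v) A)"
  have bl: "bounded_linear ((*v) A)" by (rule matrix_vector_mul_bounded_linear)
  have le: "norm (A *v v) \<le> ?s * norm v" for v using onorm[OF bl] .
  have s: "?s \<ge> 0" by (rule onorm_pos_le[OF bl])
  have c: "continuous_on (sphere 0 1) (\<lambda>v. norm (A *v v))"
    by (intro continuous_intros bounded_linear.continuous_on[OF bl])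
  have "(axis undefined 1 :: real ^ 'n) \<in> sphere 0 1" by simp
  then obtain v where v: "norm v = 1" and max: "\<And>y. norm y = 1 \<Longrightarrow> norm (A *v y) \<le> norm (A *v v)"
    using continuous_attains_sup[OF compact_sphere _ c] by (metis empty_iff mem_sphere_0)
  have "?s \<le> norm (A *v v)"
  proof (rule onorm_le)
    fix y :: "real ^ 'n"
    show "norm (A *v y) \<le> norm (A *v v) * norm y"
    proof (cases "y = 0")
      case False
      have "norm (A *v (y /\<^sub>R norm y)) \<le> norm (A *v v)" using False by (intro max) simp
      then show ?thesis using False by (simp add: matrix_vector_mult_scaleR field_simps)
    qed simp
  qed
  with le[of v] v have nv: "norm (A *v v) = ?s" by simp
  \<comment> \<open>Equality in the norm bound: the defect in the eigenvector equation has a squared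
    norm that is also at most 0.\<close>
  have "(norm (transpose A *v (A *v v) - ?s\<^sup>2 *\<^sub>R v))\<^sup>2
      = (norm (transpose A *v (A *v v)))\<^sup>2 - (?s\<^sup>2)\<^sup>2"
  proof -
    have "(transpose A *v (A *v v)) \<bullet> v = ?s\<^sup>2"
      using nv by (simp only: inner_transpose_mult power2_norm_eq_inner[symmetric])
    moreover have "v \<bullet> v = 1" using v by (simp flip: power2_norm_eq_inner)
    moreover have "(norm (z - d *\<^sub>R v))\<^sup>2 = (norm z)\<^sup>2 - 2 * d * (z \<bullet> v) + d\<^sup>2 * (v \<bullet> v)"
      for z :: "real ^ 'n" and d
      unfolding power2_norm_eq_inner
      by (simp add: inner_diff_left inner_diff_right inner_commute power2_eq_square)
    ultimately show ?thesis by (simp only:) (simp add: power2_eq_square)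
  qed
  also have "\<dots> \<le> 0"
    using power_mono[OF norm_transpose_mult_le[OF le, of "A *v v"], of 2] nv
    by (simp add: power2_eq_square)
  finally have "transpose A *v (A *v v) = ?s\<^sup>2 *\<^sub>R v" by simp
  then have "\<exists>v. v \<noteq> 0 \<and> (transpose A ** A) *v v = ?s\<^sup>2 *\<^sub>R v"
    using v by (intro exI[of _ v]) (auto simp flip: matrix_vector_mul_assoc)
  then have mem: "?s \<in> singular_values A"
    unfolding singular_values_def using s by (auto intro!: exI[of _ "?s\<^sup>2"])
  have "t \<le> ?s" if "t \<in> singular_values A" for t
  proof -
    from that obtain e y where t: "t = sqrt e" and y: "y \<noteq> 0" "(transpose A ** A) *v y = e *\<^sub>R y"
      unfolding singular_values_def by blast
    have "(norm (A *v y))\<^sup>2 = (transpose A *v (A *v y)) \<bullet> y"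
      by (simp only: inner_transpose_mult power2_norm_eq_inner)
    also have "\<dots> = e * (norm y)\<^sup>2"
      unfolding matrix_vector_mul_assoc y(2) by (simp add: power2_norm_eq_inner)
    finally have "e * (norm y)\<^sup>2 \<le> ?s\<^sup>2 * (norm y)\<^sup>2"
      using power_mono[OF le[of y], of 2] by (simp add: power_mult_distrib)
    then have "e \<le> ?s\<^sup>2" using y by simp
    then show ?thesis using s unfolding t by (simp add: real_le_lsqrt)
  qed
  then show ?thesis
    unfolding sigma_max_def by (intro Greatest_equality mem)
qed

lemma norm_mult_le_sigma_max: "norm (A *v v) \<le> sigma_max A * norm v"
  for A :: "real ^ 'n ^ 'm"
  unfolding sigma_max_eq_onorm by (rule onorm[OF matrix_vector_mul_bounded_linear])

text \<open>Surjectivity of \<open>A\<close> makes its transpose injective, and an injective linear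
  map in finite dimension is bounded below. This later converts bounds on the transpose applied to
  multipliers into bounds on the multipliers.\<close>

lemma full_row_rank_bounded_below:
  fixes A :: "real ^ 'n ^ 'm"
  assumes "rank A = CARD('m)"
  obtains c where "c > 0" "\<And>y. c * norm y \<le> norm (transpose A *v y)"
proof -
  have surj: "surj ((*v) A)" using assms by (simp add: full_rank_surjective)
  have "y = 0" if "transpose A *v y = 0" for y
  proof -
    obtain x where "y = A *v x" using surj by (meson surjD)
    then have "y \<bullet> y = (transpose A *v y) \<bullet> x" by (simp only: inner_transpose_mult)
    then show ?thesis using that by simp
  qed
  then have "inj ((*v) (transpose A))"
    by (simp only: linear_injective_0[OF matrix_vector_mul_linear]) blast
  then show ?thesis
    using linear_inj_bounded_below_pos[OF matrix_vector_mul_linear] that by metis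
qed

text \<open>Ensures that the iteration cap \<open>lmax\<close> of APG is positive.\<close>

lemma sigma_max_pos:
  fixes A :: "real ^ 'n ^ 'm"
  assumes "rank A = CARD('m)"
  shows "sigma_max A > 0"
proof -
  obtain c where c: "c > 0" "\<And>y. c * norm y \<le> norm (transpose A *v y)"
    using full_row_rank_bounded_below[OF assms] by blast
  have "c \<le> norm (transpose A *v axis undefined 1)"
    using c(2)[of "axis undefined 1"] by simp
  also have "\<dots> \<le> sigma_max A"
    using norm_transpose_mult_le[OF norm_mult_le_sigma_max, of A "axis undefined 1"] by simp
  finally show ?thesis using c(1) by simp
qed


section \<open>The augmented Lagrangian\<close>

lemma l1_norm_triangle: "l1_norm (x + y) \<le> l1_norm x + l1_norm y"
  unfolding l1_norm_def sum.distrib[symmetric] by (rule sum_mono) simp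

lemma l1_norm_scaleR: "l1_norm (c *\<^sub>R x) = \<bar>c\<bar> * l1_norm x"
  by (simp add: l1_norm_def abs_mult sum_distrib_left)

lemma norm_le_l1_norm: "norm x \<le> l1_norm x"
  unfolding l1_norm_def by (rule norm_le_l1_cart)

lemma l1_norm_le_norm: "l1_norm x \<le> real CARD('n) * norm x"
  for x :: "real ^ 'n"
proof -
  have "l1_norm x \<le> (\<Sum>i\<in>(UNIV :: 'n set). norm x)"
    unfolding l1_norm_def by (rule sum_mono) (rule component_le_norm_cart)
  then show ?thesis by simp
qed

lemma continuous_on_l1_norm: "continuous_on S l1_norm"
  unfolding l1_norm_def[abs_def] by (intro continuous_intros)

lemma convex_on_l1_norm:
  assumes "convex S"
  shows "convex_on S l1_norm"
proof (rule convex_onI[OF _ assms])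
  fix t :: real and x y :: "real ^ 'n"
  assume "0 < t" "t < 1"
  then show "l1_norm ((1 - t) *\<^sub>R x + t *\<^sub>R y) \<le> (1 - t) * l1_norm x + t * l1_norm y"
    using l1_norm_triangle[of "(1 - t) *\<^sub>R x" "t *\<^sub>R y"] by (simp add: l1_norm_scaleR)
qed

lemma convex_l1_ball: "convex {z :: real ^ 'n. l1_norm z \<le> r}"
proof (rule convexI)
  fix x y :: "real ^ 'n" and u v :: real
  assume *: "x \<in> {z. l1_norm z \<le> r}" "y \<in> {z. l1_norm z \<le> r}" "0 \<le> u" "0 \<le> v" "u + v = 1"
  have "l1_norm (u *\<^sub>R x + v *\<^sub>R y) \<le> u * l1_norm x + v * l1_norm y"
    using l1_norm_triangle[of "u *\<^sub>R x" "v *\<^sub>R y"] * by (simp add: l1_norm_scaleR)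
  also have "\<dots> \<le> r" using * by (intro convex_bound_le) auto
  finally show "u *\<^sub>R x + v *\<^sub>R y \<in> {z. l1_norm z \<le> r}" by simp
qed

lemma compact_l1_ball: "compact {z :: real ^ 'n. l1_norm z \<le> r}"
proof -
  have "bounded {z :: real ^ 'n. l1_norm z \<le> r}"
    unfolding bounded_iff using norm_le_l1_norm order_trans by blast
  moreover have "closed {z :: real ^ 'n. l1_norm z \<le> r}"
    by (intro closed_Collect_le continuous_on_l1_norm continuous_intros)
  ultimately show ?thesis by (simp add: compact_eq_bounded_closed)
qed

text \<open>The exact Taylor expansion of the quadratic term: the sign of its remainder gives
  convexity, and bounding the remainder by \<open>sigma_max A\<close> gives smoothness.\<close>

lemma half_norm_square_expand:
  fixes A :: "real ^ 'n ^ 'm"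
  shows "1 / 2 * (norm (A *v y - c))\<^sup>2 = 1 / 2 * (norm (A *v v - c))\<^sup>2
    + (transpose A *v (A *v v - c)) \<bullet> (y - v) + 1 / 2 * (norm (A *v (y - v)))\<^sup>2"
proof -
  have *: "A *v y - c = (A *v v - c) + A *v (y - v)"
    by (simp add: matrix_vector_mult_diff_distrib)
  show ?thesis
    unfolding inner_transpose_mult *
    by (simp only: power2_norm_eq_inner inner_add_left inner_add_right)
      (simp add: inner_commute)
qed

text \<open>\<open>gradient\<close> is a definite description, so uniqueness of the derivative is
  proved along with its value.\<close>

lemma gradient_half_norm_square:
  fixes A :: "real ^ 'n ^ 'm"
  shows "gradient (\<lambda>z. 1 / 2 * (norm (A *v z - c))\<^sup>2) v = transpose A *v (A *v v - c)"
proof -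
  let ?f = "\<lambda>z. 1 / 2 * (norm (A *v z - c))\<^sup>2"
  have res: "((\<lambda>z. A *v z - c) has_derivative (*v) A) (at v)"
    using has_derivative_diff[OF bounded_linear_imp_has_derivative[OF
        matrix_vector_mul_bounded_linear[of A]] has_derivative_const[of c]] by simp
  have "((\<lambda>z. 1 / 2 * ((A *v z - c) \<bullet> (A *v z - c))) has_derivative
      (\<lambda>h. 1 / 2 * ((A *v v - c) \<bullet> (A *v h) + (A *v h) \<bullet> (A *v v - c)))) (at v)"
    by (intro has_derivative_mult_right has_derivative_inner res)
  also have "(\<lambda>h. 1 / 2 * ((A *v v - c) \<bullet> (A *v h) + (A *v h) \<bullet> (A *v v - c)))
      = (\<lambda>h. h \<bullet> (transpose A *v (A *v v - c)))"
    by (simp only: inner_commute[of _ "transpose A *v _"] inner_transpose_mult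
        inner_commute[of _ "A *v v - c"]) simp
  finally have d: "GDERIV ?f v :> (transpose A *v (A *v v - c))"
    by (simp add: gderiv_def power2_norm_eq_inner)
  have "g = transpose A *v (A *v v - c)" if "GDERIV ?f v :> g" for g
  proof -
    have "(\<lambda>h. h \<bullet> g) = (\<lambda>h. h \<bullet> (transpose A *v (A *v v - c)))"
      using that d unfolding gderiv_def by (rule has_derivative_unique)
    then show ?thesis by (metis vector_eq_ldot)
  qed
  with d show ?thesis unfolding gradient_def by (intro the_equality)
qed

text \<open>Brings both exits of APG to one form. The inequality is stated for every
  \<open>y\<close>, not only in the ball, because a later test point at distance \<open>lam\<close>
  from the iterate may leave the ball.\<close>

lemma fal_step_approx_optimal:
  fixes A :: "real ^ 'n ^ 'm" and b th :: "real ^ 'm" and x xs :: "real ^ 'n"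
    and lam eta eps tau :: real
  assumes rank: "rank A = CARD('m)"
    and feas: "A *v xs = b" and eta: "l1_norm xs \<le> eta" "eta > 0"
    and pos: "lam > 0" "eps > 0" "tau > 0"
  defines "P \<equiv> (\<lambda>z. lam * l1_norm z + 1 / 2 * (norm (A *v z - (b + lam *\<^sub>R th)))\<^sup>2)"
    and "out \<equiv> fal_step A b eta lam eps tau th x"
  shows "\<exists>g. norm g \<le> tau \<and> (\<forall>y. P out + g \<bullet> (y - out) \<le> P y + eps)"
proof -
  let ?p = "\<lambda>z :: real ^ 'n. lam * l1_norm z"
  let ?f = "\<lambda>z. 1 / 2 * (norm (A *v z - (b + lam *\<^sub>R th)))\<^sup>2"
  define eta' where "eta' = eta + lam / 2 * (norm th)\<^sup>2"
  define F where "F = {z :: real ^ 'n. l1_norm z \<le> eta'}"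
  define s where "s = sigma_max A"
  define R where "R = eta' + norm x"
  define lmax where "lmax = s * R * sqrt (2 / eps)"
  have s: "s > 0" unfolding s_def by (rule sigma_max_pos[OF rank])
  have eta': "eta' \<ge> eta" unfolding eta'_def using pos by simp
  have R: "R > 0" unfolding R_def using eta' eta by (simp add: add_pos_nonneg)
  have lmax: "lmax > 0" unfolding lmax_def using s R pos by simp
  have xsF: "xs \<in> F" unfolding F_def using eta eta' by simp
  have F: "compact F" "convex F" "F \<noteq> {}"
    unfolding F_def using compact_l1_ball convex_l1_ball xsF[unfolded F_def] by auto
  have p: "convex_on F ?p" "continuous_on F ?p"
    using F(2) pos by (auto intro!: convex_on_cmul convex_on_l1_norm continuous_intros
        continuous_on_l1_norm)
  have lower: "?f v + gradient ?f v \<bullet> (y - v) \<le> ?f y" for v y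
    unfolding gradient_half_norm_square half_norm_square_expand[of A y _ v] by simp
  have upper: "?f y \<le> ?f v + gradient ?f v \<bullet> (y - v) + s\<^sup>2 / 2 * (norm (y - v))\<^sup>2" for v y
    unfolding gradient_half_norm_square half_norm_square_expand[of A y _ v]
    using power_mono[OF norm_mult_le_sigma_max[of A "y - v"], of 2]
    by (simp add: s_def power_mult_distrib)
  \<comment> \<open>The cap \<open>lmax\<close> is calibrated for this: points of \<open>F\<close>
    are within \<open>R\<close> of \<open>x\<close>, and \<open>eps * lmax^2\<close> equals
    \<open>2 * s^2 * R^2\<close>.\<close>
  have rate: "2 * s\<^sup>2 * (norm (y - x))\<^sup>2 \<le> eps * lmax\<^sup>2" if y: "y \<in> F" for y
  proof -
    have "norm (y - x) \<le> norm y + norm x" by (rule norm_triangle_ineq4)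
    also have "\<dots> \<le> R"
      using y norm_le_l1_norm[of y] unfolding F_def R_def by simp
    finally have "(norm (y - x))\<^sup>2 \<le> R\<^sup>2" by (intro power_mono) auto
    then have "2 * s\<^sup>2 * (norm (y - x))\<^sup>2 \<le> 2 * s\<^sup>2 * R\<^sup>2" by (intro mult_left_mono) auto
    also have "\<dots> = eps * lmax\<^sup>2"
      unfolding lmax_def using pos by (simp add: power_mult_distrib)
    finally show ?thesis .
  qed
  have out: "out = apg_output ?p ?f (\<lambda>z. 1 / 2 * (norm (z - x))\<^sup>2) F (s\<^sup>2) x lmax tau"
    unfolding out_def fal_step_def Let_def lmax_def R_def s_def F_def eta'_def
    by (simp add: diff_diff_eq)
  have "(out \<in> F \<and> (\<forall>y\<in>F. P out \<le> P y + eps))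
      \<or> (\<exists>g\<in>subdifferential (\<lambda>z. ?p z + ?f z) out. norm g \<le> tau)"
    unfolding out P_def using pos
    by (intro apg_output_cases[OF F p _ refl lower upper lmax rate]) auto
  then show ?thesis
  proof
    assume opt: "out \<in> F \<and> (\<forall>y\<in>F. P out \<le> P y + eps)"
    \<comment> \<open>The ball \<open>F\<close> is so large that \<open>P\<close> outside of it exceeds its value at \<open>xs\<close>.\<close>
    have Pxs: "P xs = lam * l1_norm xs + lam * (lam / 2 * (norm th)\<^sup>2)"
      unfolding P_def using feas pos by (simp add: power_mult_distrib power2_eq_square)
    have "P out \<le> P y + eps" for y
    proof (cases "y \<in> F")
      case False
      have "P xs \<le> lam * eta'"
        unfolding Pxs eta'_def using eta pos by (simp add: distrib_left)
      also have "\<dots> \<le> lam * l1_norm y" using False pos unfolding F_def by simp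
      also have "\<dots> \<le> P y" unfolding P_def by simp
      finally show ?thesis using opt xsF by force
    qed (use opt in blast)
    then show ?thesis using pos by (intro exI[of _ 0]) simp
  next
    assume "\<exists>g\<in>subdifferential (\<lambda>z. ?p z + ?f z) out. norm g \<le> tau"
    then obtain g where "norm g \<le> tau" "\<And>y. P out + g \<bullet> (y - out) \<le> P y"
      unfolding subdifferential_def P_def by blast
    moreover have "P y \<le> P y + eps" for y using pos by simp
    ultimately show ?thesis by (meson order_trans)
  qed
qed

text \<open>The test point is \<open>v\<close> moved by length \<open>lam\<close> in the direction of
  \<open>g\<close> minus the gradient of the quadratic term.\<close>

lemma approx_subgradient_residual:
  fixes A :: "real ^ 'n ^ 'm" and c :: "real ^ 'm" and v g :: "real ^ 'n" and lam eps B :: real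
  defines "P \<equiv> (\<lambda>z. lam * l1_norm z + 1 / 2 * (norm (A *v z - c))\<^sup>2)"
  assumes lam: "lam > 0" and eps: "eps \<le> B * lam\<^sup>2"
    and sub: "\<And>y. P v + g \<bullet> (y - v) \<le> P y + eps"
  shows "norm (transpose A *v (A *v v - c))
    \<le> norm g + lam * (B + real CARD('n) + (sigma_max A)\<^sup>2 / 2)"
proof -
  define G where "G = transpose A *v (A *v v - c)"
  define s where "s = sigma_max A"
  have D: "norm (g - G) \<le> lam * (B + real CARD('n) + s\<^sup>2 / 2)"
  proof (cases "g - G = 0")
    case True
    \<comment> \<open>In the degenerate case only \<open>B >= 0\<close> has to be shown; testing at
      \<open>v\<close> itself yields it.\<close>
    have "0 \<le> eps" using sub[of v] by simp
    then have "0 \<le> B * lam\<^sup>2" using eps by simp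
    then have "0 \<le> B" using lam by (simp add: zero_le_mult_iff)
    then show ?thesis using True lam by simp
  next
    case False
    define d where "d = (lam / norm (g - G)) *\<^sub>R (g - G)"
    have nd: "norm d = lam" unfolding d_def using False lam by simp
    have gd: "(g - G) \<bullet> d = lam * norm (g - G)"
      unfolding d_def using False by (simp add: power2_norm_eq_inner[symmetric] power2_eq_square)
    have "l1_norm (v + d) \<le> l1_norm v + real CARD('n) * lam"
      using l1_norm_triangle[of v d] l1_norm_le_norm[of d] nd by simp
    then have 1: "lam * l1_norm (v + d) \<le> lam * l1_norm v + real CARD('n) * lam\<^sup>2"
      using mult_left_mono[of "l1_norm (v + d)" "l1_norm v + real CARD('n) * lam" lam] lam
      by (simp add: distrib_left power2_eq_square mult_ac)
    have 2: "(norm (A *v d))\<^sup>2 \<le> s\<^sup>2 * lam\<^sup>2"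
      using power_mono[OF norm_mult_le_sigma_max[of A d], of 2] nd
      by (simp add: s_def power_mult_distrib)
    have "1 / 2 * (norm (A *v (v + d) - c))\<^sup>2
        = 1 / 2 * (norm (A *v v - c))\<^sup>2 + G \<bullet> d + 1 / 2 * (norm (A *v d))\<^sup>2"
      using half_norm_square_expand[of A "v + d" c v] by (simp add: G_def)
    \<comment> \<open>The error, the change of the 1-norm part and the quadratic remainder are all
      of order \<open>lam^2\<close> for a step of length \<open>lam\<close>, so division by
      \<open>lam\<close> leaves a bound of order \<open>lam\<close>.\<close>
    then have "lam * norm (g - G) \<le> B * lam\<^sup>2 + real CARD('n) * lam\<^sup>2 + s\<^sup>2 * lam\<^sup>2 / 2"
      using sub[of "v + d"] 1 2 eps gd unfolding P_def inner_diff_left add_diff_cancel_left'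
      by linarith
    then have "lam * norm (g - G) \<le> lam * (lam * (B + real CARD('n) + s\<^sup>2 / 2))"
      by (simp add: power2_eq_square algebra_simps)
    then show ?thesis using lam by simp
  qed
  have "norm G \<le> norm g + norm (g - G)"
    using norm_triangle_ineq4[of g "g - G"] by simp
  then show ?thesis using D unfolding G_def s_def by simp
qed

theorem theorem3p1:
  fixes A :: "real ^ 'n ^ 'm" and b :: "real ^ 'm"
    and x_star x0 :: "real ^ 'n" and eta :: real
    and lam eps tau :: "nat \<Rightarrow> real"
  assumes "CARD('m) < CARD('n)"
    and "rank A = CARD('m)"
    and "basis_pursuit_solution A b x_star"
    and "eta > 0" and "eta \<ge> l1_norm x_star"
    and "\<And>k. k \<ge> 1 \<Longrightarrow> lam k > 0 \<and> eps k > 0 \<and> tau k > 0"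
    and "antimono_on {1..} lam" and "lam \<longlonglongrightarrow> 0"
    and "antimono_on {1..} eps" and "eps \<longlonglongrightarrow> 0"
    and "\<exists>B1. \<forall>k\<ge>1. eps k / (lam k)\<^sup>2 \<le> B1"
    and "antimono_on {1..} tau" and "tau \<longlonglongrightarrow> 0"
    and "\<exists>B2. \<forall>k\<ge>1. tau k / lam k \<le> B2"
    and "(\<lambda>k. tau k / lam k) \<longlonglongrightarrow> 0"
  shows "bounded (fal_x A b lam eps tau x0 eta ` {1..})
    \<and> (\<forall>x_bar. limit_point (\<lambda>k. fal_x A b lam eps tau x0 eta (Suc k)) x_bar
          \<longrightarrow> basis_pursuit_solution A b x_bar)"
proof -
  \<comment> \<open>All sequences are shifted by one, so that index 0 already carries valid
    parameters: \<open>X k\<close> and \<open>T k\<close> are the iterate and the multiplier of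
    outer iteration \<open>k + 1\<close>.\<close>
  define X where "X = (\<lambda>k. fal_x A b lam eps tau x0 eta (Suc k))"
  define T where "T = (\<lambda>k. fal_theta A b lam eps tau x0 eta (Suc k))"
  define l where "l = (\<lambda>k. lam (Suc k))"
  define e where "e = (\<lambda>k. eps (Suc k))"
  define t where "t = (\<lambda>k. tau (Suc k))"
  define r where "r = (\<lambda>k. t k / l k)"
  define P where "P = (\<lambda>k z. l k * l1_norm z + 1 / 2 * (norm (A *v z - (b + l k *\<^sub>R T k)))\<^sup>2)"
  obtain B1 B2 where B: "\<And>k. k \<ge> 1 \<Longrightarrow> eps k / (lam k)\<^sup>2 \<le> B1" "\<And>k. k \<ge> 1 \<Longrightarrow> tau k / lam k \<le> B2"
    using assms(11,14) by blast
  have pos: "l k > 0" "e k > 0" "t k > 0" for k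
    using assms(6)[of "Suc k"] by (auto simp: l_def e_def t_def)
  have eB: "e k \<le> B1 * (l k)\<^sup>2" for k
    using B(1)[of "Suc k"] pos[of k] by (simp add: e_def l_def pos_divide_le_eq)
  have tB: "t k \<le> B2 * l k" for k
    using B(2)[of "Suc k"] pos[of k] by (simp add: t_def l_def pos_divide_le_eq)
  have feas: "A *v x_star = b" and opt: "\<And>y. A *v y = b \<Longrightarrow> l1_norm x_star \<le> l1_norm y"
    using assms(3) by (auto simp: basis_pursuit_solution_def is_arg_min_linorder)
  have T_Suc: "T (Suc k) = T k - (1 / l k) *\<^sub>R (A *v X k - b)" for k
    by (simp add: T_def X_def l_def)
  have "\<forall>k. \<exists>g. norm g \<le> t k \<and> (\<forall>y. P k (X k) + g \<bullet> (y - X k) \<le> P k y + e k)"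
    using fal_step_approx_optimal[OF assms(2) feas assms(5,4) pos]
    unfolding P_def X_def T_def l_def e_def t_def by simp
  then obtain g where g: "\<And>k. norm (g k) \<le> t k"
    and sub: "\<And>k y. P k (X k) + g k \<bullet> (y - X k) \<le> P k y + e k"
    by metis

  \<comment> \<open>Boundedness of the multipliers\<close>
  define M where "M = B2 + (B1 + real CARD('n) + (sigma_max A)\<^sup>2 / 2)"
  obtain c where c: "c > 0" "\<And>y. c * norm y \<le> norm (transpose A *v y)"
    using full_row_rank_bounded_below[OF assms(2)] by blast
  have TSuc_le: "norm (T (Suc k)) \<le> M / c" for k
  proof -
    \<comment> \<open>The multiplier update makes the residual of the augmented term a multiple of
      the next multiplier.\<close>
    have "A *v X k - (b + l k *\<^sub>R T k) = (- l k) *\<^sub>R T (Suc k)"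
      unfolding T_Suc using pos[of k] by (simp add: algebra_simps)
    then have "l k * norm (transpose A *v T (Suc k))
        = norm (transpose A *v (A *v X k - (b + l k *\<^sub>R T k)))"
      using pos[of k] by (simp only: matrix_vector_mult_scaleR norm_scaleR)
    also have "\<dots> \<le> norm (g k) + l k * (B1 + real CARD('n) + (sigma_max A)\<^sup>2 / 2)"
      using sub[of k] unfolding P_def
      by (intro approx_subgradient_residual[OF pos(1) eB[of k]])
    also have "\<dots> \<le> l k * M"
      using g[of k] tB[of k] by (simp add: M_def algebra_simps)
    finally have "norm (transpose A *v T (Suc k)) \<le> M" using pos[of k] by simp
    then have "c * norm (T (Suc k)) \<le> M" using c(2) order_trans by blast
    then show ?thesis using c(1) by (simp add: pos_le_divide_eq mult.commute)
  qed
  have M: "0 \<le> M / c" using TSuc_le[of 0] norm_ge_zero order_trans by blast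
  have T_le: "norm (T k) \<le> M / c" for k
    using TSuc_le M by (cases k) (auto simp: T_def)

  \<comment> \<open>An upper bound for the 1-norm of the iterates\<close>
  define D where "D = (M / c)\<^sup>2 / 2 + B1"
  define a where "a = l1_norm x_star"
  have X_le: "(1 - r k) * l1_norm (X k) \<le> (1 + r k) * a + l k * D" for k
  proof -
    have "l k * l1_norm (X k) \<le> P k (X k)" by (simp add: P_def)
    \<comment> \<open>Feasibility of \<open>x_star\<close> leaves only the multiplier in the
      quadratic term. This term and the error \<open>e k\<close> are of order
      \<open>(l k)^2\<close>; \<open>D\<close> collects their constants.\<close>
    moreover have "P k x_star = l k * a + (l k)\<^sup>2 * ((norm (T k))\<^sup>2 / 2)"
      using pos[of k] by (simp add: P_def a_def feas power_mult_distrib)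
    moreover have "(l k)\<^sup>2 * ((norm (T k))\<^sup>2 / 2) \<le> (l k)\<^sup>2 * ((M / c)\<^sup>2 / 2)"
      using T_le[of k] by (intro mult_left_mono divide_right_mono power_mono) auto
    moreover have "- (g k \<bullet> (x_star - X k)) \<le> t k * (a + l1_norm (X k))"
    proof -
      have "- (g k \<bullet> (x_star - X k)) \<le> norm (g k) * norm (x_star - X k)"
        using Cauchy_Schwarz_ineq2[of "g k" "x_star - X k"] by linarith
      also have "\<dots> \<le> t k * (a + l1_norm (X k))"
      proof (intro mult_mono g)
        show "norm (x_star - X k) \<le> a + l1_norm (X k)"
          using norm_triangle_ineq4[of x_star "X k"] norm_le_l1_norm[of x_star]
            norm_le_l1_norm[of "X k"] by (simp add: a_def)
      qed (use pos[of k] in auto)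
      finally show ?thesis .
    qed
    ultimately have "l k * l1_norm (X k)
        \<le> l k * a + (l k)\<^sup>2 * ((M / c)\<^sup>2 / 2) + B1 * (l k)\<^sup>2 + t k * (a + l1_norm (X k))"
      using sub[of k x_star] eB[of k] by linarith
    \<comment> \<open>The subgradient term contains the unknown 1-norm of \<open>X k\<close>; with
      \<open>t k\<close> written as \<open>l k * r k\<close> it moves to the left side, producing
      the factor \<open>1 - r k\<close>.\<close>
    moreover have "t k = l k * r k" using pos[of k] by (simp add: r_def)
    ultimately have "l k * ((1 - r k) * l1_norm (X k)) \<le> l k * ((1 + r k) * a + l k * D)"
      by (simp add: D_def algebra_simps power2_eq_square)
    then show ?thesis using pos[of k] by simp
  qed
  have l0: "l \<longlonglongrightarrow> 0" unfolding l_def using assms(8) by (rule LIMSEQ_Suc)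
  have r0: "r \<longlonglongrightarrow> 0" unfolding r_def l_def t_def using assms(15) by (rule LIMSEQ_Suc)
  have rhs: "(\<lambda>k. (1 + r k) * a + l k * D) \<longlonglongrightarrow> a"
    using tendsto_add[OF tendsto_mult[OF tendsto_add[OF tendsto_const r0] tendsto_const]
      tendsto_mult[OF l0 tendsto_const], of 1 a D] by simp

  \<comment> \<open>Boundedness of the iterates\<close>
  have "bounded (range X)"
  proof -
    have "eventually (\<lambda>k. r k < 1 / 2) sequentially" using r0 by (rule order_tendstoD) simp
    moreover have "eventually (\<lambda>k. (1 + r k) * a + l k * D < a + 1) sequentially"
      using rhs by (rule order_tendstoD) simp
    ultimately have "eventually (\<lambda>k. norm (X k) \<le> 2 * (a + 1)) sequentially"
    proof eventually_elim
      case (elim k)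
      have "0 \<le> l1_norm (X k)" using norm_le_l1_norm norm_ge_zero order_trans by blast
      then have "1 / 2 * l1_norm (X k) \<le> (1 - r k) * l1_norm (X k)"
        using elim by (intro mult_right_mono) auto
      also have "\<dots> < a + 1" using X_le[of k] elim by simp
      finally show ?case using norm_le_l1_norm[of "X k"] by simp
    qed
    then show ?thesis unfolding Bseq_eq_bounded[symmetric] by (rule BfunI)
  qed
  moreover have "fal_x A b lam eps tau x0 eta ` {1..} = range X"
  proof -
    have "{1..} = range Suc" by (auto simp: image_iff Suc_le_eq gr0_conv_Suc)
    then show ?thesis by (simp add: X_def image_image)
  qed
  ultimately have bd: "bounded (fal_x A b lam eps tau x0 eta ` {1..})" by simp

  \<comment> \<open>Vanishing residuals and optimality of limit points\<close>
  have res: "(\<lambda>k. A *v X k - b) \<longlonglongrightarrow> 0"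
  proof (rule Lim_null_comparison)
    have "norm (A *v X k - b) \<le> l k * (2 * (M / c))" for k
    proof -
      have "A *v X k - b = l k *\<^sub>R (T k - T (Suc k))"
        unfolding T_Suc using pos[of k] by simp
      then have "norm (A *v X k - b) = l k * norm (T k - T (Suc k))"
        using pos[of k] by simp
      also have "norm (T k - T (Suc k)) \<le> 2 * (M / c)"
        using norm_triangle_ineq4[of "T k" "T (Suc k)"] T_le[of k] T_le[of "Suc k"] by simp
      finally show ?thesis using pos[of k] by simp
    qed
    then show "eventually (\<lambda>k. norm (A *v X k - b) \<le> l k * (2 * (M / c))) sequentially" by simp
    show "(\<lambda>k. l k * (2 * (M / c))) \<longlonglongrightarrow> 0"
      using tendsto_mult_right[OF l0, of "2 * (M / c)"] by simp
  qed
  have "basis_pursuit_solution A b x_bar" if "limit_point X x_bar" for x_bar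
  proof -
    from that obtain q where q: "strict_mono q" "(X \<circ> q) \<longlonglongrightarrow> x_bar"
      unfolding limit_point_def by blast
    have Aq: "(\<lambda>k. A *v X (q k) - b) \<longlonglongrightarrow> A *v x_bar - b"
      using bounded_linear.tendsto[OF matrix_vector_mul_bounded_linear q(2)]
      by (intro tendsto_intros) (simp add: o_def)
    have "(\<lambda>k. A *v X (q k) - b) \<longlonglongrightarrow> 0"
      using LIMSEQ_subseq_LIMSEQ[OF res q(1)] by (simp add: o_def)
    then have "A *v x_bar - b = 0" using Aq LIMSEQ_unique by blast
    then have Ab: "A *v x_bar = b" by simp
    have rq: "(\<lambda>k. r (q k)) \<longlonglongrightarrow> 0"
      using LIMSEQ_subseq_LIMSEQ[OF r0 q(1)] by (simp add: o_def)
    have "(\<lambda>k. l1_norm (X (q k))) \<longlonglongrightarrow> l1_norm x_bar"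
      using continuous_on_tendsto_compose[OF continuous_on_l1_norm q(2), of UNIV]
      by (simp add: o_def)
    then have lhs: "(\<lambda>k. (1 - r (q k)) * l1_norm (X (q k))) \<longlonglongrightarrow> l1_norm x_bar"
      using tendsto_mult[OF tendsto_diff[OF tendsto_const rq, of 1]] by fastforce
    \<comment> \<open>The bound \<open>X_le\<close> is passed to the limit along the subsequence;
      its right side tends to the optimal value \<open>a\<close>.\<close>
    have "l1_norm x_bar \<le> a"
      using lhs LIMSEQ_subseq_LIMSEQ[OF rhs q(1)]
      by (rule LIMSEQ_le) (auto simp: X_le)
    then show ?thesis
      using Ab opt unfolding basis_pursuit_solution_def is_arg_min_linorder a_def
      by (meson order_trans)
  qed
  with bd show ?thesis unfolding X_def by blast
qed

end
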